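(* Let $q>1$ be real, let $r$ and $s$ be positive integers, and let $t$ be a real number. Then \begin{align*} T[r,s,t] &= \sum_{a=0}^{r-1}\sum_{b=0}^{r-1-a}\binom{a+s-1}{a,\, b}(1-q)^b\,\zeta_q[s+t+a,\,r-a-b] +\sum_{a=0}^{s-1}\sum_{b=0}^{s-1-a}\binom{a+r-1}{a,\, b}(1-q)^b\,\zeta_q[r+t+a,\,s-a-b]\\ &\quad-\sum_{j=1}^{\min(r,s)}\binom{r+s-j-1}{r-j,\, s-j}(1-q)^j\,\varphi[r+s+t-j],\\ T[\overline{r},\overline{s},t] &= \sum_{a=0}^{r-1}\sum_{b=0}^{r-1-a}\binom{a+s-1}{a,\, b}(1-q)^b\,\zeta_q[\,\overline{s+t+a},\,r-a-b] +\sum_{a=0}^{s-1}\sum_{b=0}^{s-1-a}\binom{a+r-1}{a,\, b}(1-q)^b\,\zeta_q[\,\overline{r+t+a},\,s-a-b]\\ &\quad-\sum_{j=1}^{\min(r,s)}\binom{r+s-j-1}{r-j,\, s-j}(1-q)^j\,\varphi[\,\overline{r+s+t-j}\,],\\ T[r,\overline{s},t] &= \sum_{a=0}^{r-1}\sum_{b=0}^{r-1-a}\binom{a+s-1}{a,\, b}(1-q)^b\,\zeta_q[\,\overline{s+t+a},\,\overline{r-a-b}\,] +\sum_{a=0}^{s-1}\sum_{b=0}^{s-1-a}\binom{a+r-1}{a,\, b}(1-q)^b\,\zeta_q[\,r+t+a,\,\overline{s-a-b}\,]\\ &\quad+\sum_{j=1}^{\min(r,s)}\binom{r+s-j-1}{r-j,\,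 s-j}(1-q)^j(1+q)^{j-r-s-t}\,\zeta_{q^2}[r+s+t-j]. \end{align*}
   Context: Throughout $q>1$ is real and $[n]_q=(q^n-1)/(q-1)=\sum_{j=0}^{n-1}q^j$ for positive integers $n$. For real $s_1,\dots,s_k$ and signs $\sigma_j\in\{-1,1\}$, the $q$-Euler sum is $\zeta_q[s_1,\dots,s_k;\sigma_1,\dots,\sigma_k]=\sum_{n_1>\cdots>n_k>0}\prod_{j=1}^k \sigma_j^{n_j}q^{(s_j-1)n_j}/[n_j]_q^{s_j}$; in argument lists one writes $s_j$ when $\sigma_j=1$ and $\overline{s_j}$ when $\sigma_j=-1$ (e.g. $\zeta_q[\overline{x},y]=\zeta_q[x,y;-1,1]$). For $\sigma,\tau\in\{-1,1\}$, $T[r,s,t;\sigma,\tau]=\sum_{u,v\ge1}\sigma^u\tau^v q^{(r+t-1)u+(s+t-1)v}/([u]_q^r[v]_q^s[u+v]_q^t)$, with $T[r,s,t]=T[r,s,t;1,1]$, $T[\overline r,\overline s,t]=T[r,s,t;-1,-1]$, $T[r,\overline s,t]=T[r,s,t;1,-1]$. Also $\varphi[s;\sigma]=\sum_{n\ge1}(n-1)\sigma^nq^{(s-1)n}/[n]_q^s$, $\varphi[s]=\varphi[s;1]$, $\varphi[\overline s]=\varphi[s;-1]$. $\zeta_{q^2}[x]$ denotes $\zeta_q[x]$ with $q$ replaced by $q^2$. The trinomial coefficient is $\binom{z}{a,\,b}=\binom{z}{a}\binom{z-a}{b}$ for nonnegative integers $a,b$. *)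

theory Defs
  imports "HOL-Analysis.Analysis"
begin

definition q_num :: "real \<Rightarrow> nat \<Rightarrow> real" where
  "q_num q n = (q ^ n - 1) / (q - 1)"

definition decr_indices :: "nat \<Rightarrow> nat list set" where
  "decr_indices k = {ns. length ns = k \<and> sorted_wrt (>) ns \<and> (\<forall>n\<in>set ns. 0 < n)}"

text \<open>
  For \<open>q > 1\<close> all the series below converge absolutely for all real exponents: the general term
  of a \<open>q\<close>-Euler sum is bounded by a constant times \<open>q\<close> to the power \<open>- (n\<^sub>1 + \<dots> + n\<^sub>k)\<close>, and
  similarly for the other two. Unordered summation is therefore appropriate.

  The argument lists are \<open>ss = [s\<^sub>1, \<dots>, s\<^sub>k]\<close> and \<open>sgs = [\<sigma>\<^sub>1, \<dots>, \<sigma>\<^sub>k]\<close>; a barred argument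
  is one whose sign is \<open>-1\<close>.
\<close>

definition q_euler_sum :: "real \<Rightarrow> real list \<Rightarrow> real list \<Rightarrow> real" where
  "q_euler_sum q ss sgs =
     (\<Sum>\<^sub>\<infinity>ns\<in>decr_indices (length ss).
        \<Prod>j<length ss. (sgs ! j) ^ (ns ! j) * q powr ((ss ! j - 1) * real (ns ! j))
                          / q_num q (ns ! j) powr (ss ! j))"

definition q_tornheim :: "real \<Rightarrow> real \<Rightarrow> real \<Rightarrow> real \<Rightarrow> real \<Rightarrow> real \<Rightarrow> real" where
  "q_tornheim q r s t \<sigma> \<tau> =
     (\<Sum>\<^sub>\<infinity>(u, v)\<in>{1::nat..} \<times> {1::nat..}.
        \<sigma> ^ u * \<tau> ^ v * q powr ((r + t - 1) * real u + (s + t - 1) * real v)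
          / (q_num q u powr r * q_num q v powr s * q_num q (u + v) powr t))"

definition q_phi :: "real \<Rightarrow> real \<Rightarrow> real \<Rightarrow> real" where
  "q_phi q s \<sigma> =
     (\<Sum>\<^sub>\<infinity>n\<in>{1::nat..}. (real n - 1) * \<sigma> ^ n * q powr ((s - 1) * real n) / q_num q n powr s)"

definition trinomial :: "real \<Rightarrow> nat \<Rightarrow> nat \<Rightarrow> real" where
  "trinomial z a b = (z gchoose a) * ((z - real a) gchoose b)"

end

theory Submission
  imports Defs
begin

text \<open>
  Put \<open>c = q - 1\<close>, \<open>x = [u]\<close>, \<open>y = [v]\<close>, \<open>X = 1 + c * x = q ^ u\<close>, \<open>Y = 1 + c * y = q ^ v\<close> and
  \<open>N = [u + v] = x + y + c * x * y\<close>. Since \<open>N - X * y = x\<close>, a finite geometric sum decomposes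
  \<open>1 / (x * y ^ s)\<close> into terms with denominators \<open>x * N ^ s\<close>, \<open>y ^ (s - k) * N ^ (k + 1)\<close> and \<open>N ^ s\<close>.
  Replacing \<open>x\<close> by \<open>x - \<alpha>\<close> there and comparing coefficients of \<open>\<alpha> ^ (r - 1)\<close> gives a partial fraction
  decomposition of \<open>1 / (x ^ r * y ^ s)\<close>. Multiplied by the remaining factor of the Tornheim summand,
  its three families become summands of double \<open>q\<close>-Euler sums with \<open>(n\<^sub>1, n\<^sub>2) = (u + v, u)\<close> or
  \<open>(u + v, v)\<close>, and functions of \<open>n = u + v\<close> alone. By absolute convergence the series may be split and
  rearranged; each \<open>n\<close> in the third family carries the weight \<open>\<Sum> \<sigma> ^ u * \<tau> ^ v\<close> over \<open>u + v = n\<close>,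
  which is \<open>(n - 1) * \<sigma> ^ n\<close> for \<open>\<sigma> = \<tau>\<close>, whereas for opposite signs it vanishes at odd \<open>n\<close> and
  equals \<open>- 1\<close> at even \<open>n\<close>, so that \<open>[2 * n]\<close> for \<open>q\<close>, which is \<open>1 + q\<close> times \<open>[n]\<close> for \<open>q\<^sup>2\<close>, brings in
  the base \<open>q\<^sup>2\<close>.
\<close>

subsection \<open>Partial fractions\<close>

text \<open>With \<open>w = X * N'\<close>, the relation \<open>N - X * y = A\<close> gives
  \<open>y' - w = y' * N' * A\<close>, so \<open>A'\<close> times the difference of the
  \<open>(m+1)\<close>-st powers of \<open>y'\<close> and \<open>w\<close> loses its factor
  \<open>A\<close>. In the leftover \<open>A' * w ^ Suc m\<close>, one factor
  \<open>X = 1 + c * A\<close> is split to produce the term without \<open>A'\<close>. A commutative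
  ring with explicit inverses is used so that the identity applies to formal power series.\<close>

lemma geometric_partial_fraction:
  fixes A A' N N' y y' X c :: "'a::comm_ring_1"
  assumes "A * A' = 1" "N * N' = 1" "y * y' = 1" and X: "X = 1 + c * A" and N: "N = A + X * y"
  shows "A' * y' ^ Suc m = N' ^ Suc m * (X ^ m * A')
           + (\<Sum>k\<le>m. y' ^ (Suc m - k) * (X ^ k * N' ^ Suc k)) + c * (X ^ m * N' ^ Suc m)"
proof -
  let ?w = "X * N'"
  have "y' - ?w = y' * (N * N') - X * (y * y') * N'"
    by (simp add: assms(2,3))
  also have "\<dots> = y' * N' * A"
    unfolding N by (simp add: algebra_simps)
  finally have diff: "y' - ?w = y' * N' * A" .
  have "A' * (y' ^ Suc m - ?w ^ Suc m) = A' * ((y' - ?w) * (\<Sum>k<Suc m. y' ^ (m - k) * ?w ^ k))"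
    using power_diff_sumr2[of y' "Suc m" ?w] power_diff_sumr2[of ?w "Suc m" y']
    by (simp add: algebra_simps)
  also have "\<dots> = (A * A') * (\<Sum>k\<le>m. y' * N' * (y' ^ (m - k) * ?w ^ k))"
    unfolding diff by (simp add: lessThan_Suc_atMost sum_distrib_left mult_ac)
  also have "\<dots> = (\<Sum>k\<le>m. y' ^ (Suc m - k) * (X ^ k * N' ^ Suc k))"
    by (simp add: assms(1), intro sum.cong refl)
       (simp add: Suc_diff_le power_mult_distrib mult_ac)
  finally have "A' * y' ^ Suc m = A' * ?w ^ Suc m + (\<Sum>k\<le>m. y' ^ (Suc m - k) * (X ^ k * N' ^ Suc k))"
    by (simp add: algebra_simps)
  moreover have "A' * ?w ^ Suc m = N' ^ Suc m * (X ^ m * A') + c * (X ^ m * N' ^ Suc m)"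
  proof -
    have "A' * ?w ^ Suc m = X ^ m * N' ^ Suc m * (X * A')"
      by (simp add: power_mult_distrib mult_ac)
    also have "X * A' = A' + c * (A * A')"
      by (simp add: X algebra_simps)
    finally show ?thesis
      by (simp add: assms(1) algebra_simps)
  qed
  ultimately show ?thesis
    by simp
qed

section \<open>Coefficients of the power series and binomial identities\<close>

lemma fps_nth_linear_power:
  fixes x c :: real
  shows "fps_nth ((fps_const x - fps_const c * fps_X) ^ n) k = of_nat (n choose k) * x ^ (n - k) * (- c) ^ k"
proof -
  have "(fps_const x - fps_const c * fps_X) ^ n = (fps_const (- c) * fps_X + fps_const x) ^ n"
    by (simp add: fps_const_neg[symmetric] del: fps_const_neg)
  also have "\<dots> = (\<Sum>i\<le>n. fps_const (of_nat (n choose i) * (- c) ^ i * x ^ (n - i)) * fps_X ^ i)"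
    unfolding binomial_ring
    by (intro sum.cong refl) (simp add: power_mult_distrib mult_ac fps_of_nat[symmetric] flip: fps_const_mult)
  finally show ?thesis
    by (auto simp: fps_sum_nth fps_X_power_nth binomial_eq_0 mult_delta_right)
qed

lemma fps_nth_inverse_linear_power:
  fixes x c :: real
  assumes "x \<noteq> 0" "n > 0"
  shows "fps_nth (inverse (fps_const x - fps_const c * fps_X) ^ n) k =
           of_nat (n + k - 1 choose k) * c ^ k / x ^ (n + k)"
proof -
  have factor: "fps_const x - fps_const c * fps_X = fps_const x * (1 - fps_const (c / x) * fps_X)"
    using assms by (simp add: algebra_simps flip: mult.assoc)
  have "inverse (fps_const x - fps_const c * fps_X) ^ n
      = fps_const (1 / x ^ n) * inverse ((1 - fps_const (c / x) * fps_X) ^ n)"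
    unfolding factor by (simp add: fps_inverse_mult fps_inverse_power power_mult_distrib fps_const_inverse power_inverse inverse_eq_divide power_one_over)
  also have "fps_nth \<dots> k = of_nat (n + k - 1 choose k) * c ^ k / x ^ (n + k)"
    using assms by (simp add: one_minus_const_fps_X_neg_power' power_divide power_add)
  finally show ?thesis .
qed

text \<open>Both sides count the pairs of disjoint subsets of sizes \<open>a\<close> and
  \<open>b\<close> in a set of size \<open>a + p\<close>. This brings the second family of
  coefficients into the same form as the first.\<close>

lemma choose_choose_swap:
  assumes "b \<le> p"
  shows "(a + b choose b) * (a + p choose (p - b)) = (a + p choose a) * (p choose b)"
proof -
  have "(a + p choose (a + b)) * (a + b choose a) = (a + p choose a) * (p choose b)"
    using choose_mult[of a "a + b" "a + p"] assms by simp
  moreover have "a + b choose a = (a + b choose b)"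
    using binomial_symmetric[of b "a + b"] by simp
  moreover have "a + p choose (a + b) = (a + p choose (p - b))"
    using binomial_symmetric[of "a + b" "a + p"] assms by simp
  ultimately show ?thesis
    by (simp add: mult.commute)
qed

lemma sum_triangle_antidiagonals:
  fixes h :: "nat \<Rightarrow> nat \<Rightarrow> 'a::comm_monoid_add"
  shows "(\<Sum>k\<le>m. \<Sum>b\<le>k. h (k - b) b) = (\<Sum>a\<le>m. \<Sum>b\<le>m - a. h a b)"
  unfolding sum.Sigma[OF finite_atMost ballI[OF finite_atMost]]
  by (rule sum.reindex_bij_witness[of _ "\<lambda>(a, b). (a + b, b)" "\<lambda>(k, b). (k - b, b)"]) auto

text \<open>The geometric identity handles only a first power of \<open>1 / x\<close>. Perturbing
  \<open>x\<close> by a formal variable turns \<open>1 / x\<close> into a generating function of all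
  its powers, and the coefficient of degree \<open>p\<close> is the claim. Where
  \<open>m - b\<close> or \<open>p - b\<close> truncates to 0, the binomial coefficient in front is
  0.\<close>

theorem tornheim_partial_fraction:
  fixes x y c X Y N :: real and p m :: nat
  assumes "x \<noteq> 0" "y \<noteq> 0" "N \<noteq> 0"
    and X: "X = 1 + c * x" and Y: "Y = 1 + c * y" and N: "N = x + y + c * x * y"
  shows "1 / (x ^ Suc p * y ^ Suc m) =
     (\<Sum>a\<le>p. \<Sum>b\<le>p - a. of_nat (a + m choose a) * of_nat (m choose b) * (- c) ^ b *
         (Y ^ a * X ^ (m - b) / (x ^ (Suc p - a - b) * N ^ (Suc m + a))))
   + (\<Sum>a\<le>m. \<Sum>b\<le>m - a. of_nat (a + p choose a) * of_nat (p choose b) * (- c) ^ b *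
         (X ^ a * Y ^ (p - b) / (y ^ (Suc m - a - b) * N ^ (Suc p + a))))
   - (\<Sum>j\<le>min p m. of_nat (p + m - j choose (p - j)) * of_nat (m choose j) * (- c) ^ Suc j *
         (Y ^ (p - j) * X ^ (m - j) / N ^ (Suc p + m - j)))"
  (is "_ = ?S1 + ?S2 - ?S3")
proof -
  \<comment> \<open>These are \<open>x\<close>, \<open>X\<close> and \<open>N\<close> with
    \<open>x\<close> replaced by \<open>x - fps_X\<close> and \<open>y\<close> fixed;
    \<open>N\<close> changes by the multiple \<open>Y\<close> because \<open>N = Y * x + y\<close>.
    The factor \<open>fps_const 1\<close> matches the shape of the coefficient lemmas.\<close>
  define A where "A = fps_const x - fps_const 1 * fps_X"
  define X' where "X' = fps_const X - fps_const c * fps_X"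
  define N' where "N' = fps_const N - fps_const Y * fps_X"
  have AA: "A * inverse A = 1" and NN: "N' * inverse N' = 1"
    using assms by (simp_all add: A_def N'_def inverse_mult_eq_1')
  have X'_eq: "X' = 1 + fps_const c * A"
    unfolding X'_def A_def X
    by (rule fps_ext) (simp add: algebra_simps)
  have N'_eq: "N' = A + X' * fps_const y"
    unfolding N'_def A_def X'_def X Y N
    by (rule fps_ext) (simp add: algebra_simps)
  have "inverse A * fps_const (1 / y) ^ Suc m =
     inverse N' ^ Suc m * (X' ^ m * inverse A)
       + (\<Sum>k\<le>m. fps_const (1 / y) ^ (Suc m - k) * (X' ^ k * inverse N' ^ Suc k))
       + fps_const c * (X' ^ m * inverse N' ^ Suc m)"
    by (rule geometric_partial_fraction[OF AA NN _ X'_eq N'_eq]) (use assms in simp)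
  then have eq: "fps_nth (inverse A * fps_const (1 / y) ^ Suc m) p =
     fps_nth (inverse N' ^ Suc m * (X' ^ m * inverse A)) p
       + (\<Sum>k\<le>m. fps_nth (fps_const (1 / y) ^ (Suc m - k) * (X' ^ k * inverse N' ^ Suc k)) p)
       + fps_nth (fps_const c * (X' ^ m * inverse N' ^ Suc m)) p"
    by (simp only: fps_add_nth fps_sum_nth)
  have A_nth: "fps_nth (inverse A) k = 1 / x ^ Suc k" for k
    using fps_nth_inverse_linear_power[of x 1 1 k] assms(1) by (simp add: A_def)
  have X_nth: "fps_nth (X' ^ n) k = of_nat (n choose k) * X ^ (n - k) * (- c) ^ k" for n k
    unfolding X'_def by (rule fps_nth_linear_power)
  have N_nth: "fps_nth (inverse N' ^ Suc n) k = of_nat (n + k choose k) * Y ^ k / N ^ (Suc n + k)" for n k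
    using fps_nth_inverse_linear_power[of N "Suc n" Y k] assms(3) by (simp add: N'_def)
  have "fps_nth (inverse A * fps_const (1 / y) ^ Suc m) p = 1 / (x ^ Suc p * y ^ Suc m)"
    by (simp add: A_nth power_divide del: power_Suc)
  \<comment> \<open>Degree \<open>a\<close> comes from the power of \<open>inverse N'\<close>,
    degree \<open>b\<close> from \<open>X' ^ m\<close>, and the remaining \<open>p - a - b\<close>
    from \<open>inverse A\<close>.\<close>
  moreover have "fps_nth (inverse N' ^ Suc m * (X' ^ m * inverse A)) p = ?S1"
    unfolding fps_mult_nth sum_distrib_left atLeast0AtMost
    by (intro sum.cong refl) (simp add: A_nth X_nth N_nth add.commute Suc_diff_le mult_ac del: power_Suc)
  moreover have "(\<Sum>k\<le>m. fps_nth (fps_const (1 / y) ^ (Suc m - k) * (X' ^ k * inverse N' ^ Suc k)) p) = ?S2"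
  proof -
    let ?h = "\<lambda>a b. of_nat (a + p choose a) * of_nat (p choose b) * (- c) ^ b *
         (X ^ a * Y ^ (p - b) / (y ^ (Suc m - a - b) * N ^ (Suc p + a)))"
    have "fps_nth (fps_const (1 / y) ^ (Suc m - k) * (X' ^ k * inverse N' ^ Suc k)) p
        = (\<Sum>b\<le>k. ?h (k - b) b)" (is "?l = _") if "k \<le> m" for k
    proof -
      have "?l = (\<Sum>b\<le>p. 1 / y ^ (Suc m - k) * (fps_nth (X' ^ k) b * fps_nth (inverse N' ^ Suc k) (p - b)))"
        unfolding fps_const_power fps_mult_left_const_nth fps_mult_nth[of "X' ^ k"]
        by (simp add: power_divide sum_distrib_left atLeast0AtMost del: power_Suc)
      also have "\<dots> = (\<Sum>b\<le>k. ?h (k - b) b)"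
      \<comment> \<open>Outside the common range both sides vanish: for \<open>b > k\<close> the
        coefficient of \<open>X' ^ k\<close> is 0, and for \<open>b > p\<close> the binomial
        \<open>p choose b\<close> is 0.\<close>
      proof (rule sum.mono_neutral_cong)
        fix b assume "b \<in> {..p} \<inter> {..k}"
        then obtain a where b: "b \<le> p" and k: "k = a + b"
          by (metis IntD1 IntD2 atMost_iff le_add_diff_inverse2)
        have e: "Suc (a + b) + (p - b) = Suc p + a" "a + b + (p - b) = a + p"
          using b by simp_all
        have ch: "real (a + b choose b) * real (a + p choose (p - b)) = real (a + p choose a) * real (p choose b)"
          by (metis choose_choose_swap[OF b] of_nat_mult)
        have "1 / y ^ (Suc m - k) * (fps_nth (X' ^ k) b * fps_nth (inverse N' ^ Suc k) (p - b))
            = (real (a + b choose b) * real (a + p choose (p - b))) * (- c) ^ b *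
              (X ^ a * Y ^ (p - b) / (y ^ (Suc m - a - b) * N ^ (Suc p + a)))"
          unfolding X_nth N_nth k e by (simp del: power_Suc)
        then show "1 / y ^ (Suc m - k) * (fps_nth (X' ^ k) b * fps_nth (inverse N' ^ Suc k) (p - b)) = ?h (k - b) b"
          unfolding ch k by simp
      qed (auto simp: X_nth binomial_eq_0)
      finally show ?thesis .
    qed
    then show ?thesis
      unfolding sum_triangle_antidiagonals[symmetric, of ?h] by (intro sum.cong refl) auto
  qed
  \<comment> \<open>The outer \<open>c\<close> and the \<open>(- c) ^ j\<close> from
    \<open>X' ^ m\<close> combine to \<open>- ((- c) ^ Suc j)\<close>. As \<open>X' ^ m\<close> has
    degree at most \<open>m\<close>, the sum stops at \<open>min p m\<close>.\<close>
  moreover have "fps_nth (fps_const c * (X' ^ m * inverse N' ^ Suc m)) p = - ?S3"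
  proof -
    have "fps_nth (fps_const c * (X' ^ m * inverse N' ^ Suc m)) p =
       (\<Sum>b\<le>p. c * (fps_nth (X' ^ m) b * fps_nth (inverse N' ^ Suc m) (p - b)))"
      by (simp add: fps_mult_nth[of "X' ^ m"] sum_distrib_left atLeast0AtMost del: power_Suc)
    also have "\<dots> = (\<Sum>j\<le>min p m. - (of_nat (p + m - j choose (p - j)) * of_nat (m choose j) * (- c) ^ Suc j *
         (Y ^ (p - j) * X ^ (m - j) / N ^ (Suc p + m - j))))"
    proof (rule sum.mono_neutral_cong)
      fix b assume "b \<in> {..p} \<inter> {..min p m}"
      then have e: "m + (p - b) = p + m - b" "Suc m + (p - b) = Suc p + m - b"
        by auto
      show "c * (fps_nth (X' ^ m) b * fps_nth (inverse N' ^ Suc m) (p - b)) =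
         - (of_nat (p + m - b choose (p - b)) * of_nat (m choose b) * (- c) ^ Suc b *
         (Y ^ (p - b) * X ^ (m - b) / N ^ (Suc p + m - b)))"
        unfolding X_nth N_nth e by (simp add: mult_ac)
    qed (auto simp: X_nth binomial_eq_0)
    finally show ?thesis
      by (simp only: sum_negf)
  qed
  ultimately show ?thesis
    using eq by (simp del: power_Suc)
qed

subsection \<open>The summands\<close>

text \<open>The factor of a \<open>q\<close>-Euler summand that belongs to one index, without its
  sign, so that one decomposition serves all choices of signs.\<close>

definition q_term :: "real \<Rightarrow> real \<Rightarrow> nat \<Rightarrow> real" where
  "q_term q s n = q powr ((s - 1) * real n) / q_num q n powr s"

lemma q_num_pos: "q > 1 \<Longrightarrow> n \<ge> 1 \<Longrightarrow> q_num q n > 0"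
  unfolding q_num_def by (simp add: one_less_power)

lemma power_eq_q_num: "q \<noteq> 1 \<Longrightarrow> q ^ n = 1 + (q - 1) * q_num q n"
  unfolding q_num_def by simp

lemma q_num_add: "q \<noteq> 1 \<Longrightarrow> q_num q (u + v) = q_num q u + q_num q v + (q - 1) * q_num q u * q_num q v"
  unfolding q_num_def by (simp add: power_add divide_simps) (simp add: algebra_simps)

lemma q_num_double: "q_num q (2 * n) = (1 + q) * q_num (q\<^sup>2) n"
proof (cases "q = 1 \<or> q = - 1")
  case False
  then show ?thesis
    unfolding q_num_def power_mult
    by (simp add: divide_simps power2_eq_1_iff) (simp add: algebra_simps power2_eq_square)
\<comment> \<open>At \<open>q = 1\<close> both quotients are 0 as divisions by zero; at
  \<open>q = - 1\<close> the left numerator and the factor \<open>1 + q\<close> vanish.\<close>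
qed (auto simp: q_num_def power_mult)

text \<open>The term equals \<open>d powr s * (1 / q) ^ n\<close> with
  \<open>d = q ^ n / [n]\<close>, and \<open>d\<close> stays between \<open>q - 1\<close> and
  \<open>q\<close>. The sign of \<open>s\<close> decides which endpoint bounds
  \<open>d powr s\<close>, whence the maximum.\<close>

lemma q_term_bound:
  assumes "q > 1"
  obtains K where "K \<ge> 0" "\<And>n. n \<ge> 1 \<Longrightarrow> \<bar>q_term q s n\<bar> \<le> K * (1 / q) ^ n"
proof
  let ?K = "max ((q - 1) powr s) (q powr s)"
  show "?K \<ge> 0"
    by (simp add: le_max_iff_disj)
  fix n :: nat assume n: "n \<ge> 1"
  define d where "d = q ^ n / q_num q n"
  have pos: "q ^ n > 0" "q_num q n > 0"
    using assms n q_num_pos by auto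
  have "q ^ 1 \<le> q ^ n"
    using assms n by (intro power_increasing) auto
  then have "(q - 1) * q_num q n \<le> q ^ n" "q ^ n \<le> q * q_num q n"
    using assms by (auto simp: q_num_def field_simps)
  then have d: "q - 1 \<le> d" "d \<le> q"
    using pos by (simp_all add: d_def field_simps)
  have "d powr s \<le> ?K"
  proof (cases "s \<ge> 0")
    case True
    then have "d powr s \<le> q powr s"
      using d assms by (intro powr_mono2) auto
    then show ?thesis by simp
  next
    case False
    then have "d powr s \<le> (q - 1) powr s"
      using d assms by (intro powr_mono2') auto
    then show ?thesis by simp
  qed
  moreover have "q_term q s n = d powr s * (1 / q) ^ n"
  proof -
    have "q powr ((s - 1) * real n) = (q ^ n) powr s / q ^ n"
      using assms by (simp add: powr_realpow[symmetric] powr_powr powr_diff[symmetric] algebra_simps)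
    then show ?thesis
      using pos by (simp add: q_term_def d_def powr_divide power_one_over)
  qed
  ultimately show "\<bar>q_term q s n\<bar> \<le> ?K * (1 / q) ^ n"
    using assms by (simp add: mult_right_mono)
qed

text \<open>The powers of \<open>q ^ u\<close> and \<open>q ^ v\<close> left over by the partial
  fractions are exactly those that make the numerator factor over the indices
  \<open>n\<^sub>1 = u + v\<close> and \<open>n\<^sub>2 = u\<close>.\<close>

lemma q_term_prod_eq:
  assumes "q > 1" "u \<ge> 1" "v \<ge> 1" "b \<le> m" "a + b \<le> p"
  shows "(q ^ v) ^ a * (q ^ u) ^ (m - b) / (q_num q u ^ (Suc p - a - b) * q_num q (u + v) ^ (Suc m + a))
           * (q powr ((real (Suc p) + t - 1) * real u + (real (Suc m) + t - 1) * real v) / q_num q (u + v) powr t)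
       = q_term q (real (Suc m) + t + real a) (u + v) * q_term q (real (Suc p) - real a - real b) u"
proof -
  have pos: "q_num q u > 0" "q_num q (u + v) > 0" "q > 0"
    using assms q_num_pos by auto
  have ab: "Suc p - a - b = Suc p - (a + b)" "a + b \<le> Suc p"
    using assms by auto
  have num: "(q ^ v) ^ a * (q ^ u) ^ (m - b) * q powr ((real (Suc p) + t - 1) * real u + (real (Suc m) + t - 1) * real v)
      = q powr ((real (Suc m) + t + real a - 1) * real (u + v)) * q powr ((real (Suc p) - real a - real b - 1) * real u)"
    using assms pos
    by (simp add: powr_realpow[symmetric] powr_powr powr_add[symmetric] of_nat_diff)
       (simp add: algebra_simps)
  have den: "q_num q (u + v) ^ (Suc m + a) * q_num q (u + v) powr t = q_num q (u + v) powr (real (Suc m) + t + real a)"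
    using pos by (simp only: powr_realpow[symmetric] powr_add[symmetric]) (simp add: algebra_simps)
  have den': "q_num q u ^ (Suc p - a - b) = q_num q u powr (real (Suc p) - real a - real b)"
    unfolding ab(1) using pos ab(2) by (simp only: powr_realpow[symmetric] of_nat_diff) (simp add: algebra_simps)
  have "?thesis \<longleftrightarrow> ((q ^ v) ^ a * (q ^ u) ^ (m - b) * q powr ((real (Suc p) + t - 1) * real u + (real (Suc m) + t - 1) * real v)) /
          (q_num q u ^ (Suc p - a - b) * (q_num q (u + v) ^ (Suc m + a) * q_num q (u + v) powr t)) =
        q_term q (real (Suc m) + t + real a) (u + v) * q_term q (real (Suc p) - real a - real b) u"
    by (simp add: mult_ac del: power_Suc of_nat_Suc)
  then show ?thesis
    unfolding num den den' q_term_def by (simp add: mult_ac)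
qed

text \<open>Here the total exponents of \<open>q ^ u\<close> and \<open>q ^ v\<close> are both
  \<open>p + m + t - j\<close>, so the term depends on \<open>u + v\<close> alone.\<close>

lemma q_term_diagonal_eq:
  assumes "q > 1" "u \<ge> 1" "v \<ge> 1" "j \<le> p" "j \<le> m"
  shows "(q ^ v) ^ (p - j) * (q ^ u) ^ (m - j) / q_num q (u + v) ^ (Suc p + m - j)
           * (q powr ((real (Suc p) + t - 1) * real u + (real (Suc m) + t - 1) * real v) / q_num q (u + v) powr t)
       = q_term q (real (Suc p) + real (Suc m) + t - real (Suc j)) (u + v)"
proof -
  have pos: "q_num q (u + v) > 0" "q > 0"
    using assms q_num_pos by auto
  have num: "(q ^ v) ^ (p - j) * (q ^ u) ^ (m - j) * q powr ((real (Suc p) + t - 1) * real u + (real (Suc m) + t - 1) * real v)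
      = q powr ((real (Suc p) + real (Suc m) + t - real (Suc j) - 1) * real (u + v))"
    using assms pos
    by (simp add: powr_realpow[symmetric] powr_powr powr_add[symmetric] of_nat_diff)
       (simp add: algebra_simps)
  have jle: "j \<le> Suc p + m"
    using assms by simp
  have den: "q_num q (u + v) ^ (Suc p + m - j) * q_num q (u + v) powr t
      = q_num q (u + v) powr (real (Suc p) + real (Suc m) + t - real (Suc j))"
    using pos jle by (simp only: powr_realpow[symmetric] powr_add[symmetric] of_nat_diff) (simp add: algebra_simps)
  show ?thesis
    unfolding q_term_def num[symmetric] den[symmetric] by simp
qed

lemma q_tornheim_summand_decomposition:
  assumes "q > 1" "u \<ge> 1" "v \<ge> 1"
  shows "q powr ((real (Suc p) + t - 1) * real u + (real (Suc m) + t - 1) * real v)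
          / (q_num q u powr real (Suc p) * q_num q v powr real (Suc m) * q_num q (u + v) powr t) =
     (\<Sum>a\<le>p. \<Sum>b\<le>p - a. of_nat (a + m choose a) * of_nat (m choose b) * (1 - q) ^ b *
         (q_term q (real (Suc m) + t + real a) (u + v) * q_term q (real (Suc p) - real a - real b) u))
   + (\<Sum>a\<le>m. \<Sum>b\<le>m - a. of_nat (a + p choose a) * of_nat (p choose b) * (1 - q) ^ b *
         (q_term q (real (Suc p) + t + real a) (u + v) * q_term q (real (Suc m) - real a - real b) v))
   - (\<Sum>j\<le>min p m. of_nat (p + m - j choose (p - j)) * of_nat (m choose j) * (1 - q) ^ Suc j *
         q_term q (real (Suc p) + real (Suc m) + t - real (Suc j)) (u + v))"
  (is "?L = ?S1 + ?S2 - ?S3")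
proof -
  let ?W = "q powr ((real (Suc p) + t - 1) * real u + (real (Suc m) + t - 1) * real v) / q_num q (u + v) powr t"
  let ?x = "q_num q u" and ?y = "q_num q v" and ?N = "q_num q (u + v)"
  have pos: "?x > 0" "?y > 0" "?N > 0" and q: "q \<noteq> 1"
    using assms q_num_pos by auto
  have "?L = 1 / (?x ^ Suc p * ?y ^ Suc m) * ?W"
    using pos by (simp only: powr_realpow) (simp add: mult_ac)
  also have "\<dots> = (\<Sum>a\<le>p. \<Sum>b\<le>p - a. of_nat (a + m choose a) * of_nat (m choose b) * (- (q - 1)) ^ b *
         ((q ^ v) ^ a * (q ^ u) ^ (m - b) / (?x ^ (Suc p - a - b) * ?N ^ (Suc m + a)) * ?W))
   + (\<Sum>a\<le>m. \<Sum>b\<le>m - a. of_nat (a + p choose a) * of_nat (p choose b) * (- (q - 1)) ^ b *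
         ((q ^ u) ^ a * (q ^ v) ^ (p - b) / (?y ^ (Suc m - a - b) * ?N ^ (Suc p + a)) * ?W))
   - (\<Sum>j\<le>min p m. of_nat (p + m - j choose (p - j)) * of_nat (m choose j) * (- (q - 1)) ^ Suc j *
         ((q ^ v) ^ (p - j) * (q ^ u) ^ (m - j) / ?N ^ (Suc p + m - j) * ?W))"
    unfolding tornheim_partial_fraction[OF pos(1,2,3)[THEN less_imp_neq, symmetric]
        power_eq_q_num[OF q] power_eq_q_num[OF q] q_num_add[OF q]]
    by (simp only: left_diff_distrib distrib_right sum_distrib_right mult.assoc)
  also have "(\<Sum>a\<le>p. \<Sum>b\<le>p - a. of_nat (a + m choose a) * of_nat (m choose b) * (- (q - 1)) ^ b *
         ((q ^ v) ^ a * (q ^ u) ^ (m - b) / (?x ^ (Suc p - a - b) * ?N ^ (Suc m + a)) * ?W)) = ?S1"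
  proof (intro sum.cong refl)
    \<comment> \<open>For \<open>b > m\<close> the truncated exponent \<open>m - b\<close> would be
      wrong, but \<open>m choose b = 0\<close> there.\<close>
    fix a b assume "a \<in> {..p}" "b \<in> {..p - a}"
    then show "of_nat (a + m choose a) * of_nat (m choose b) * (- (q - 1)) ^ b *
         ((q ^ v) ^ a * (q ^ u) ^ (m - b) / (?x ^ (Suc p - a - b) * ?N ^ (Suc m + a)) * ?W)
       = of_nat (a + m choose a) * of_nat (m choose b) * (1 - q) ^ b *
         (q_term q (real (Suc m) + t + real a) (u + v) * q_term q (real (Suc p) - real a - real b) u)"
      using q_term_prod_eq[of q u v b m a p t] assms
      by (cases "b \<le> m") (simp_all add: binomial_eq_0)
  qed
  also have "(\<Sum>a\<le>m. \<Sum>b\<le>m - a. of_nat (a + p choose a) * of_nat (p choose b) * (- (q - 1)) ^ b *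
         ((q ^ u) ^ a * (q ^ v) ^ (p - b) / (?y ^ (Suc m - a - b) * ?N ^ (Suc p + a)) * ?W)) = ?S2"
  proof (intro sum.cong refl)
    fix a b assume ab: "a \<in> {..m}" "b \<in> {..m - a}"
    \<comment> \<open>The same exponent count with \<open>(u, p)\<close> and \<open>(v, m)\<close>
      exchanged.\<close>
    have "(q ^ u) ^ a * (q ^ v) ^ (p - b) / (?y ^ (Suc m - a - b) * ?N ^ (Suc p + a)) * ?W =
       q_term q (real (Suc p) + t + real a) (u + v) * q_term q (real (Suc m) - real a - real b) v" if "b \<le> p"
      using q_term_prod_eq[of q v u b p a m t] that ab assms
      by (simp only: add.commute[of u v] add.commute[of "_ * real u" "_ * real v"]) auto
    then show "of_nat (a + p choose a) * of_nat (p choose b) * (- (q - 1)) ^ b *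
         ((q ^ u) ^ a * (q ^ v) ^ (p - b) / (?y ^ (Suc m - a - b) * ?N ^ (Suc p + a)) * ?W)
       = of_nat (a + p choose a) * of_nat (p choose b) * (1 - q) ^ b *
         (q_term q (real (Suc p) + t + real a) (u + v) * q_term q (real (Suc m) - real a - real b) v)"
      by (cases "b \<le> p") (simp_all only:, simp_all add: binomial_eq_0)
  qed
  also have "(\<Sum>j\<le>min p m. of_nat (p + m - j choose (p - j)) * of_nat (m choose j) * (- (q - 1)) ^ Suc j *
         ((q ^ v) ^ (p - j) * (q ^ u) ^ (m - j) / ?N ^ (Suc p + m - j) * ?W)) = ?S3"
    by (intro sum.cong refl) (subst q_term_diagonal_eq, use assms in auto)
  finally show ?thesis .
qed

subsection \<open>Convergence and rearrangement\<close>

lemma summable_on_geometric_bound: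
  fixes f :: "nat \<times> nat \<Rightarrow> real"
  assumes "\<bar>z\<bar> < 1" and "\<And>u v. u \<ge> 1 \<Longrightarrow> v \<ge> 1 \<Longrightarrow> \<bar>f (u, v)\<bar> \<le> K * (z ^ u * z ^ v)"
  shows "f summable_on {1..} \<times> {1..}"
proof -
  have geo: "((\<lambda>n. \<bar>z\<bar> ^ n) has_sum (\<bar>z\<bar> / (1 - \<bar>z\<bar>))) {1..}"
    using assms(1) by (intro has_sum_geometric_from_1) auto
  have "(\<lambda>(u, v). \<bar>z\<bar> ^ u * \<bar>z\<bar> ^ v) summable_on {1::nat..} \<times> {1::nat..}"
    using has_sum_cmult_right[OF geo] summable_on_cmult_left[OF has_sum_imp_summable[OF geo]]
    by (intro summable_on_SigmaI[where g = "\<lambda>u. \<bar>z\<bar> ^ u * (\<bar>z\<bar> / (1 - \<bar>z\<bar>))"]) (simp_all del: times_divide_eq_right)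
  then have "(\<lambda>x. norm (K * (case x of (u, v) \<Rightarrow> \<bar>z\<bar> ^ u * \<bar>z\<bar> ^ v))) summable_on {1::nat..} \<times> {1::nat..}"
    unfolding summable_on_iff_abs_summable_on_real[symmetric] by (rule summable_on_cmult_right)
  then have "(\<lambda>x. norm (f x)) summable_on {1..} \<times> {1..}"
  proof (rule Infinite_Sum.abs_summable_on_comparison_test)
    fix x :: "nat \<times> nat" assume "x \<in> {1..} \<times> {1..}"
    then obtain u v where x: "x = (u, v)" "u \<ge> 1" "v \<ge> 1" by auto
    have "\<bar>f (u, v)\<bar> \<le> K * (z ^ u * z ^ v)"
      using assms(2) x by blast
    also have "\<dots> \<le> \<bar>K * (z ^ u * z ^ v)\<bar>" by simp
    finally show "norm (f x) \<le> norm (K * (case x of (u, v) \<Rightarrow> \<bar>z\<bar> ^ u * \<bar>z\<bar> ^ v))"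
      by (simp add: x abs_mult power_abs)
  qed
  then show ?thesis
    using summable_on_iff_abs_summable_on_real by blast
qed

lemma abs_sign_power: "\<sigma> \<in> {-1, 1} \<Longrightarrow> \<bar>\<sigma> ^ n\<bar> = (1::real)"
  by (auto simp: power_abs)

text \<open>Since \<open>\<tau> ^ 2 = 1\<close>, the signs of a Tornheim summand become those of a
  double sum in the indices \<open>u + v\<close> and \<open>u\<close>; this fixes which arguments
  are barred.\<close>

lemma sign_power_cancel: "\<tau> \<in> {-1, 1} \<Longrightarrow> \<tau> ^ (u + v) * (\<sigma> * \<tau>) ^ u = \<sigma> ^ u * (\<tau>::real) ^ v"
  by (auto simp: power_add power_mult_distrib simp flip: power_mult_distrib)

lemma q_term_prod_summable:
  assumes "q > 1" "\<sigma> \<in> {-1, 1}" "\<tau> \<in> {-1, 1}"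
  shows "(\<lambda>(u, v). \<sigma> ^ u * \<tau> ^ v * (q_term q A (u + v) * q_term q B u)) summable_on {1..} \<times> {1..}"
proof -
  obtain K L where K: "K \<ge> 0" "\<And>n. n \<ge> 1 \<Longrightarrow> \<bar>q_term q A n\<bar> \<le> K * (1 / q) ^ n"
    and L: "L \<ge> 0" "\<And>n. n \<ge> 1 \<Longrightarrow> \<bar>q_term q B n\<bar> \<le> L * (1 / q) ^ n"
    using q_term_bound[OF assms(1)] by metis
  show ?thesis
  proof (rule summable_on_geometric_bound[where z = "1 / q" and K = "K * L"])
    fix u v :: nat assume uv: "u \<ge> 1" "v \<ge> 1"
    \<comment> \<open>The factor at \<open>u + v\<close> already decays in both variables, so a
      constant bound suffices for the factor at \<open>u\<close>.\<close>
    have "(1 / q) ^ u \<le> 1"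
      using assms by (intro power_le_one) auto
    then have "L * (1 / q) ^ u \<le> L"
      using L(1) mult_left_mono[of "(1 / q) ^ u" 1 L] by simp
    then have "\<bar>q_term q B u\<bar> \<le> L"
      using L(2)[OF uv(1)] by linarith
    then have "\<bar>q_term q A (u + v)\<bar> * \<bar>q_term q B u\<bar> \<le> (K * (1 / q) ^ (u + v)) * L"
      using K(2)[of "u + v"] uv K(1) assms by (intro mult_mono) auto
    then show "\<bar>case (u, v) of (u, v) \<Rightarrow> \<sigma> ^ u * \<tau> ^ v * (q_term q A (u + v) * q_term q B u)\<bar>
        \<le> K * L * ((1 / q) ^ u * (1 / q) ^ v)"
      using assms by (simp add: abs_mult abs_sign_power power_add mult_ac)
  qed (use assms in auto)
qed

lemma q_term_diagonal_summable:
  assumes "q > 1" "\<sigma> \<in> {-1, 1}" "\<tau> \<in> {-1, 1}"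
  shows "(\<lambda>(u, v). \<sigma> ^ u * \<tau> ^ v * q_term q A (u + v)) summable_on {1..} \<times> {1..}"
proof -
  obtain K where K: "K \<ge> 0" "\<And>n. n \<ge> 1 \<Longrightarrow> \<bar>q_term q A n\<bar> \<le> K * (1 / q) ^ n"
    using q_term_bound[OF assms(1)] by metis
  show ?thesis
    by (rule summable_on_geometric_bound[where z = "1 / q" and K = K])
       (use assms K(2) in \<open>auto simp: abs_mult abs_sign_power power_add[symmetric]\<close>)
qed

section \<open>\<open>q\<close>-Euler sums as series over one index or over pairs\<close>

lemma q_euler_sum_one:
  "q_euler_sum q [A] [\<sigma>] = (\<Sum>\<^sub>\<infinity>n\<in>{1..}. \<sigma> ^ n * q_term q A n)"
  unfolding q_euler_sum_def
  by (rule infsum_reindex_bij_witness[of _ "\<lambda>n. [n]" hd])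
     (auto simp: decr_indices_def length_Suc_conv q_term_def)

text \<open>The substitution \<open>n\<^sub>1 = u + v\<close>, \<open>n\<^sub>2 = u\<close> turns
  \<open>n\<^sub>1 > n\<^sub>2 > 0\<close> into independent \<open>u, v \<ge> 1\<close>.\<close>

lemma q_euler_sum_two:
  "q_euler_sum q [A, B] [\<sigma>, \<tau>] =
     (\<Sum>\<^sub>\<infinity>(u, v)\<in>{1..} \<times> {1..}. \<sigma> ^ (u + v) * \<tau> ^ u * (q_term q A (u + v) * q_term q B u))"
  unfolding q_euler_sum_def
  by (rule infsum_reindex_bij_witness[of _ "\<lambda>(u, v). [u + v, u]" "\<lambda>ns. (ns ! 1, ns ! 0 - ns ! 1)"])
     (auto simp: decr_indices_def length_Suc_conv q_term_def numeral_2_eq_2 mult_ac)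

lemma q_euler_sum_has_sum:
  assumes "q > 1" "\<sigma> \<in> {-1, 1}" "\<tau> \<in> {-1, 1}"
  shows "((\<lambda>(u, v). \<sigma> ^ u * \<tau> ^ v * (q_term q A (u + v) * q_term q B u))
           has_sum q_euler_sum q [A, B] [\<tau>, \<sigma> * \<tau>]) ({1..} \<times> {1..})"
  using has_sum_infsum[OF q_term_prod_summable[OF assms]] assms
  by (simp add: q_euler_sum_two sign_power_cancel)

lemma q_euler_sum_has_sum':
  assumes "q > 1" "\<sigma> \<in> {-1, 1}" "\<tau> \<in> {-1, 1}"
  shows "((\<lambda>(u, v). \<sigma> ^ u * \<tau> ^ v * (q_term q A (u + v) * q_term q B v))
           has_sum q_euler_sum q [A, B] [\<sigma>, \<sigma> * \<tau>]) ({1..} \<times> {1..})"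
  using q_euler_sum_has_sum[OF assms(1,3,2), of A B]
  by (subst has_sum_reindex_bij_witness[where i = prod.swap and j = prod.swap and T = "{1..} \<times> {1..}"])
     (auto simp: mult_ac add.commute)

lemma has_sum_finite_sum:
  fixes f :: "'i \<Rightarrow> 'a \<Rightarrow> 'b::topological_comm_monoid_add"
  assumes "\<And>i. i \<in> I \<Longrightarrow> (f i has_sum s i) A"
  shows "((\<lambda>x. \<Sum>i\<in>I. f i x) has_sum (\<Sum>i\<in>I. s i)) A"
  using assms by (induction I rule: infinite_finite_induct) (auto intro: has_sum_add)

lemma has_sum_minus:
  fixes f g :: "'a \<Rightarrow> real"
  assumes "(f has_sum a) A" "(g has_sum b) A"
  shows "((\<lambda>x. f x - g x) has_sum (a - b)) A"
  using has_sum_add[OF assms(1) has_sum_uminusI[OF assms(2)]] by simp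

section \<open>Summation along the antidiagonals \<open>u + v = n\<close>\<close>

lemma q_term_diagonal_has_sum:
  assumes "q > 1" "\<sigma> \<in> {-1, 1}" "\<tau> \<in> {-1, 1}"
    and D: "D = (\<Sum>\<^sub>\<infinity>(u, v)\<in>{1..} \<times> {1..}. \<sigma> ^ u * \<tau> ^ v * q_term q A (u + v))"
  shows "((\<lambda>n. (\<Sum>u=1..<n. \<sigma> ^ u * \<tau> ^ (n - u)) * q_term q A n) has_sum D) {1..}"
proof (rule has_sum_SigmaD)
  have "((\<lambda>(u, v). \<sigma> ^ u * \<tau> ^ v * q_term q A (u + v)) has_sum D) ({1..} \<times> {1..})"
    unfolding D by (rule has_sum_infsum[OF q_term_diagonal_summable[OF assms(1-3)]])
  \<comment> \<open>Pairs are grouped by \<open>n = u + v\<close>; each fibre \<open>{1..<n}\<close>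
    is finite, and empty for \<open>n = 1\<close>.\<close>
  then show "((\<lambda>(n, u). \<sigma> ^ u * \<tau> ^ (n - u) * q_term q A n) has_sum D) (SIGMA n:{1..}. {1..<n})"
    by (subst has_sum_reindex_bij_witness[where i = "\<lambda>(u, v). (u + v, u)" and j = "\<lambda>(n, u). (u, n - u)"
          and T = "{1..} \<times> {1..}"]) auto
qed (auto simp: sum_distrib_right)

lemma q_term_diagonal_sum_same_sign:
  assumes "q > 1" "\<sigma> \<in> {-1, 1}"
  shows "(\<Sum>\<^sub>\<infinity>(u, v)\<in>{1..} \<times> {1..}. \<sigma> ^ u * \<sigma> ^ v * q_term q A (u + v)) = q_phi q A \<sigma>" (is "?D = _")
proof -
  have "((\<lambda>n. (\<Sum>u=1..<n. \<sigma> ^ u * \<sigma> ^ (n - u)) * q_term q A n) has_sum ?D) {1..}"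
    using assms by (intro q_term_diagonal_has_sum) auto
  then have "?D = (\<Sum>\<^sub>\<infinity>n\<in>{1..}. (\<Sum>u=1..<n. \<sigma> ^ u * \<sigma> ^ (n - u)) * q_term q A n)"
    by (simp add: infsumI)
  also have "\<dots> = q_phi q A \<sigma>"
    unfolding q_phi_def
    by (intro infsum_cong) (auto simp: q_term_def power_add[symmetric])
  finally show ?thesis .
qed

text \<open>After reversal the sum starts at exponent 1, so its partial sums alternate between
  \<open>- 1\<close> and 0, with the empty sum at \<open>n = 1\<close>.\<close>

lemma sum_alternating_signs:
  assumes "n \<ge> 1"
  shows "(\<Sum>u=1..<n. (- 1) ^ (n - u)) = (if even n then - 1 else 0 :: real)"
proof -
  have "(\<Sum>u=1..<n. (- 1) ^ (n - u)) = (\<Sum>v=1..<n. (- 1 :: real) ^ v)"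
    by (rule sum.reindex_bij_witness[of _ "\<lambda>v. n - v" "\<lambda>u. n - u"]) auto
  also have "\<dots> = (if even n then - 1 else 0)"
    using assms by (induction n rule: dec_induct) auto
  finally show ?thesis .
qed

lemma q_term_double:
  assumes "q > 1"
  shows "q_term q A (2 * n) = (1 + q) powr (- A) * q_term (q\<^sup>2) A n"
proof -
  have "q powr ((A - 1) * real (2 * n)) = (q\<^sup>2) powr ((A - 1) * real n)"
    using assms by (simp add: powr_powr powr_realpow[symmetric] mult_ac flip: powr_numeral)
  moreover have "q_num (q\<^sup>2) n \<ge> 0"
    using assms by (simp add: q_num_def)
  ultimately show ?thesis
    using assms unfolding q_term_def q_num_double by (simp add: powr_mult powr_minus divide_simps)
qed

lemma q_term_diagonal_sum_opposite_signs:
  assumes "q > 1"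
  shows "(\<Sum>\<^sub>\<infinity>(u, v)\<in>{1..} \<times> {1..}. 1 ^ u * (- 1) ^ v * q_term q A (u + v)) =
           - ((1 + q) powr (- A) * q_euler_sum (q\<^sup>2) [A] [1])" (is "?D = _")
proof -
  have "((\<lambda>n. (\<Sum>u=1..<n. 1 ^ u * (- 1) ^ (n - u)) * q_term q A n) has_sum ?D) {1..}"
    using assms by (intro q_term_diagonal_has_sum) auto
  \<comment> \<open>Odd \<open>n\<close> have weight 0 and drop out; even \<open>n\<close> have
    weight \<open>- 1\<close>, which later makes the third sum of the mixed-sign formula
    positive.\<close>
  then have "((\<lambda>n. - q_term q A n) has_sum ?D) ((*) 2 ` {1..})"
    by (rule has_sum_cong_neutral[THEN iffD1, rotated -1])
       (auto simp: sum_alternating_signs[simplified] elim!: evenE)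
  then have "((\<lambda>n. - q_term q A (2 * n)) has_sum ?D) {1..}"
    by (subst (asm) has_sum_reindex) (auto simp: inj_on_def o_def)
  then have "?D = (\<Sum>\<^sub>\<infinity>n\<in>{1..}. - ((1 + q) powr (- A)) * q_term (q\<^sup>2) A n)"
    using assms by (simp add: infsumI q_term_double)
  then show ?thesis
    by (simp add: q_euler_sum_one infsum_cmult_right' infsum_uminus)
qed

subsection \<open>The decomposition of the Tornheim sum\<close>

lemma trinomial_of_nat:
  "trinomial (real (a + k)) a b = of_nat (a + k choose a) * of_nat (k choose b)"
  by (simp add: trinomial_def binomial_gbinomial)

text \<open>The diagonal series stays unevaluated, since only its value depends on whether the two
  signs agree.\<close>

theorem q_tornheim_decomposition:
  fixes p m :: nat
  assumes "q > 1" "\<sigma> \<in> {-1, 1}" "\<tau> \<in> {-1, 1}"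
  shows "q_tornheim q (real (Suc p)) (real (Suc m)) t \<sigma> \<tau> =
     (\<Sum>a\<le>p. \<Sum>b\<le>p - a. of_nat (a + m choose a) * of_nat (m choose b) * (1 - q) ^ b *
         q_euler_sum q [real (Suc m) + t + real a, real (Suc p) - real a - real b] [\<tau>, \<sigma> * \<tau>])
   + (\<Sum>a\<le>m. \<Sum>b\<le>m - a. of_nat (a + p choose a) * of_nat (p choose b) * (1 - q) ^ b *
         q_euler_sum q [real (Suc p) + t + real a, real (Suc m) - real a - real b] [\<sigma>, \<sigma> * \<tau>])
   - (\<Sum>j\<le>min p m. of_nat (p + m - j choose (p - j)) * of_nat (m choose j) * (1 - q) ^ Suc j *
         (\<Sum>\<^sub>\<infinity>(u, v)\<in>{1..} \<times> {1..}. \<sigma> ^ u * \<tau> ^ v * q_term q (real (Suc p) + real (Suc m) + t - real (Suc j)) (u + v)))"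
  (is "_ = ?S")
proof -
  let ?Q = "{1::nat..} \<times> {1::nat..}"
  define c1 c2 c3 where "c1 a b = of_nat (a + m choose a) * of_nat (m choose b) * (1 - q) ^ b"
    and "c2 a b = of_nat (a + p choose a) * of_nat (p choose b) * (1 - q) ^ b"
    and "c3 j = of_nat (p + m - j choose (p - j)) * of_nat (m choose j) * (1 - q) ^ Suc j" for a b j
  define f1 f2 f3 where
    "f1 a b x = (case x of (u, v) \<Rightarrow> \<sigma> ^ u * \<tau> ^ v *
        (q_term q (real (Suc m) + t + real a) (u + v) * q_term q (real (Suc p) - real a - real b) u))"
    and "f2 a b x = (case x of (u, v) \<Rightarrow> \<sigma> ^ u * \<tau> ^ v *
        (q_term q (real (Suc p) + t + real a) (u + v) * q_term q (real (Suc m) - real a - real b) v))"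
    and "f3 j x = (case x of (u, v) \<Rightarrow> \<sigma> ^ u * \<tau> ^ v *
        q_term q (real (Suc p) + real (Suc m) + t - real (Suc j)) (u + v))"
    for a b j and x :: "nat \<times> nat"
  have summand: "(case x of (u, v) \<Rightarrow> \<sigma> ^ u * \<tau> ^ v
          * q powr ((real (Suc p) + t - 1) * real u + (real (Suc m) + t - 1) * real v)
          / (q_num q u powr real (Suc p) * q_num q v powr real (Suc m) * q_num q (u + v) powr t)) =
        (\<Sum>a\<le>p. \<Sum>b\<le>p - a. c1 a b * f1 a b x) + (\<Sum>a\<le>m. \<Sum>b\<le>m - a. c2 a b * f2 a b x)
          - (\<Sum>j\<le>min p m. c3 j * f3 j x)" if xQ: "x \<in> ?Q" for x
  proof -
    obtain u v where x: "x = (u, v)" "u \<ge> 1" "v \<ge> 1"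
      using xQ by (cases x) auto
    show ?thesis
      unfolding x(1) prod.case times_divide_eq_right[symmetric]
        q_tornheim_summand_decomposition[OF assms(1) x(2,3)] c1_def c2_def c3_def f1_def f2_def f3_def
      by (simp only: right_diff_distrib distrib_left sum_distrib_left mult.left_commute)
  qed
  \<comment> \<open>With the coefficients folded into constants, this is a finite linear combination
    of convergent series over pairs.\<close>
  have "((\<lambda>x. (\<Sum>a\<le>p. \<Sum>b\<le>p - a. c1 a b * f1 a b x) + (\<Sum>a\<le>m. \<Sum>b\<le>m - a. c2 a b * f2 a b x)
          - (\<Sum>j\<le>min p m. c3 j * f3 j x)) has_sum ?S) ?Q"
    unfolding c1_def[symmetric] c2_def[symmetric] c3_def[symmetric] f1_def f2_def f3_def
    by (intro has_sum_minus has_sum_add has_sum_finite_sum has_sum_cmult_right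
          q_euler_sum_has_sum q_euler_sum_has_sum' has_sum_infsum q_term_diagonal_summable assms)
  then show ?thesis
    unfolding q_tornheim_def by (subst infsum_cong[OF summand]) (auto intro: infsumI)
qed

theorem theorem1:
  fixes q t :: real and r s :: nat
  assumes "q > 1" and "r \<ge> 1" and "s \<ge> 1"
  shows "(q_tornheim q (real r) (real s) t 1 1 =
       (\<Sum>a = 0..r - 1. \<Sum>b = 0..r - 1 - a.
          trinomial (real a + real s - 1) a b * (1 - q) ^ b *
          q_euler_sum q [real s + t + real a, real r - real a - real b] [1, 1])
     + (\<Sum>a = 0..s - 1. \<Sum>b = 0..s - 1 - a.
          trinomial (real a + real r - 1) a b * (1 - q) ^ b *
          q_euler_sum q [real r + t + real a, real s - real a - real b] [1, 1])
     - (\<Sum>j = 1..min r s.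
          trinomial (real r + real s - real j - 1) (r - j) (s - j) * (1 - q) ^ j *
          q_phi q (real r + real s + t - real j) 1)) \<and>
    (q_tornheim q (real r) (real s) t (-1) (-1) =
       (\<Sum>a = 0..r - 1. \<Sum>b = 0..r - 1 - a.
          trinomial (real a + real s - 1) a b * (1 - q) ^ b *
          q_euler_sum q [real s + t + real a, real r - real a - real b] [-1, 1])
     + (\<Sum>a = 0..s - 1. \<Sum>b = 0..s - 1 - a.
          trinomial (real a + real r - 1) a b * (1 - q) ^ b *
          q_euler_sum q [real r + t + real a, real s - real a - real b] [-1, 1])
     - (\<Sum>j = 1..min r s.
          trinomial (real r + real s - real j - 1) (r - j) (s - j) * (1 - q) ^ j *
          q_phi q (real r + real s + t - real j) (-1))) \<and>
    (q_tornheim q (real r) (real s) t 1 (-1) =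
       (\<Sum>a = 0..r - 1. \<Sum>b = 0..r - 1 - a.
          trinomial (real a + real s - 1) a b * (1 - q) ^ b *
          q_euler_sum q [real s + t + real a, real r - real a - real b] [-1, -1])
     + (\<Sum>a = 0..s - 1. \<Sum>b = 0..s - 1 - a.
          trinomial (real a + real r - 1) a b * (1 - q) ^ b *
          q_euler_sum q [real r + t + real a, real s - real a - real b] [1, -1])
     + (\<Sum>j = 1..min r s.
          trinomial (real r + real s - real j - 1) (r - j) (s - j) * (1 - q) ^ j *
          (1 + q) powr (real j - real r - real s - t) *
          q_euler_sum (q\<^sup>2) [real r + real s + t - real j] [1]))"
proof -
  obtain p m where rs: "r = Suc p" "s = Suc m"
    using assms by (metis Suc_le_D One_nat_def)
  have tri: "trinomial (real a + real (Suc k) - 1) a b = of_nat (a + k choose a) * of_nat (k choose b)" for a b k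
    using trinomial_of_nat[of a k b] by simp
  \<comment> \<open>The upper entry is \<open>(p - j) + m\<close>: choosing \<open>p - j\<close>
    leaves \<open>m\<close>, and \<open>m choose (m - j)\<close> equals
    \<open>m choose j\<close>.\<close>
  have tri3: "trinomial (real r + real s - real (Suc j) - 1) (r - Suc j) (s - Suc j)
      = of_nat (p + m - j choose (p - j)) * of_nat (m choose j)" if "j \<le> min p m" for j
  proof -
    have "real r + real s - real (Suc j) - 1 = real (p - j + m)" "p - j + m = p + m - j"
      using that by (simp_all add: rs of_nat_diff)
    moreover have "m choose (m - j) = (m choose j)"
      using that binomial_symmetric[of j m] by simp
    ultimately show ?thesis
      using trinomial_of_nat[of "p - j" m "m - j"] by (simp add: rs)
  qed
  \<comment> \<open>The index \<open>j\<close> starts at 1 in the statement and at 0 in the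
    decomposition.\<close>
  have shift: "(\<Sum>j = 1..min r s. F j) = (\<Sum>j\<le>min p m. F (Suc j))" for F :: "nat \<Rightarrow> real"
    unfolding rs min_Suc_Suc One_nat_def sum.shift_bounds_cl_Suc_ivl atMost_atLeast0 ..
  have diag: "(\<Sum>j = 1..min r s. trinomial (real r + real s - real j - 1) (r - j) (s - j) * (1 - q) ^ j * G j)
      = (\<Sum>j\<le>min p m. of_nat (p + m - j choose (p - j)) * of_nat (m choose j) * (1 - q) ^ Suc j * G (Suc j))"
    for G :: "nat \<Rightarrow> real"
    unfolding shift by (intro sum.cong refl) (simp only: tri3 atMost_iff)
  have phi: "(\<Sum>\<^sub>\<infinity>(u, v)\<in>{1..} \<times> {1..}. 1 ^ u * 1 ^ v * q_term q A (u + v)) = q_phi q A 1"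
    "(\<Sum>\<^sub>\<infinity>(u, v)\<in>{1..} \<times> {1..}. (- 1) ^ u * (- 1) ^ v * q_term q A (u + v)) = q_phi q A (- 1)" for A
    using q_term_diagonal_sum_same_sign[OF assms(1)] by blast+
  have powr_eq: "(1 + q) powr (real j - real r - real s - t) = (1 + q) powr (- (real r + real s + t - real j))" for j
    by (rule arg_cong[where f = "(powr) (1 + q)"]) simp
  note gen = q_tornheim_decomposition[OF assms(1), of _ _ p m t, folded rs]
  show ?thesis
    unfolding diag mult.assoc[of _ "(1 + q) powr _"] powr_eq
    using gen[of 1 1] gen[of "-1" "-1"] gen[of 1 "-1"]
    unfolding phi q_term_diagonal_sum_opposite_signs[OF assms(1)]
    by (simp add: rs tri atMost_atLeast0 sum_negf del: of_nat_Suc power_Suc)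
qed

end
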